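(* Let $N \ge 1$ and $\alpha \in (0,N)$. Then for every $\varphi \in L^2(\mathbb{R}^N)$, \[ \mathcal{C}_{N,\alpha,0}\int_{\mathbb{R}^N} |\varphi|^2 = \int_{\mathbb{R}^N}\int_{\mathbb{R}^N} \frac{\varphi(x)}{|x|^{\frac{\alpha}{2}}}\, I_\alpha(x-y)\, \frac{\varphi(y)}{|y|^{\frac{\alpha}{2}}}\,dx\,dy + \frac12 \int_{\mathbb{R}^N}\int_{\mathbb{R}^N} \frac{I_\alpha(x-y)}{|x|^{\frac{N+\alpha}{2}}|y|^{\frac{N+\alpha}{2}}}\,\Bigl|\varphi(x)|x|^{\frac N2}-\varphi(y)|y|^{\frac N2}\Bigr|^2\,dx\,dy, \] where \[ \mathcal{C}_{N,\alpha,0}=\frac{1}{2^\alpha}\left(\frac{\Gamma\bigl(\frac{N-\alpha}{4}\bigr)}{\Gamma\bigl(\frac{N+\alpha}{4}\bigr)}\right)^2 . \]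
   Context: All functions are real-valued. For $\alpha\in(0,N)$ the Riesz potential is the function $I_\alpha:\mathbb{R}^N\setminus\{0\}\to\mathbb{R}$, \[ I_\alpha(x)=\frac{\mathcal{A}_\alpha}{|x|^{N-\alpha}},\qquad \mathcal{A}_\alpha=\frac{\Gamma\bigl(\frac{N-\alpha}{2}\bigr)}{2^\alpha\pi^{N/2}\Gamma\bigl(\frac\alpha2\bigr)}, \] where $\Gamma$ is Euler's Gamma function. *)

theory Defs
  imports "HOL-Analysis.Analysis"
begin

definition riesz_const :: "nat \<Rightarrow> real \<Rightarrow> real" where
  "riesz_const N \<alpha> =
     Gamma ((real N - \<alpha>) / 2) / (2 powr \<alpha> * pi powr (real N / 2) * Gamma (\<alpha> / 2))"

text \<open>
  The Riesz potential is only meant on nonzero arguments. The value at \<open>0\<close> is \<open>0\<close>, because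
  \<open>0 powr a = 0\<close> and division by zero gives \<open>0\<close>; it enters the integrals below only on the
  diagonal, which is a null set.
\<close>

definition riesz_potential :: "real \<Rightarrow> real ^ 'n \<Rightarrow> real" where
  "riesz_potential \<alpha> x =
     riesz_const CARD('n) \<alpha> / norm x powr (real CARD('n) - \<alpha>)"

definition sharp_const :: "nat \<Rightarrow> real \<Rightarrow> real" where
  "sharp_const N \<alpha> =
     1 / 2 powr \<alpha> * (Gamma ((real N - \<alpha>) / 4) / Gamma ((real N + \<alpha>) / 4))\<^sup>2"

text \<open>
  Elements are Lebesgue (not only Borel) measurable representatives; functions that agree almost
  everywhere are not identified.
\<close>

definition L2 :: "(real ^ 'n \<Rightarrow> real) set" where
  "L2 = {\<phi>. \<phi> \<in> borel_measurable lebesgue \<and> integrable lebesgue (\<lambda>x. \<bar>\<phi> x\<bar>\<^sup>2)}"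

definition riesz_integrand ::
    "real \<Rightarrow> (real ^ 'n \<Rightarrow> real) \<Rightarrow> real ^ 'n \<Rightarrow> real ^ 'n \<Rightarrow> real" where
  "riesz_integrand \<alpha> \<phi> x y =
     \<phi> x / norm x powr (\<alpha> / 2) * riesz_potential \<alpha> (x - y) * (\<phi> y / norm y powr (\<alpha> / 2))"

definition remainder_integrand ::
    "real \<Rightarrow> (real ^ 'n \<Rightarrow> real) \<Rightarrow> real ^ 'n \<Rightarrow> real ^ 'n \<Rightarrow> real" where
  "remainder_integrand \<alpha> \<phi> x y =
     riesz_potential \<alpha> (x - y)
       / (norm x powr ((real CARD('n) + \<alpha>) / 2) * norm y powr ((real CARD('n) + \<alpha>) / 2))
     * \<bar>\<phi> x * norm x powr (real CARD('n) / 2) - \<phi> y * norm y powr (real CARD('n) / 2)\<bar>\<^sup>2"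

end

(* Write v x = |x|^(-N/2). The composition rule for Riesz kernels shows that v is a positive
   eigenfunction, with eigenvalue C = sharp_const N alpha, of the symmetric kernel
   K x y = I_alpha (x - y) / (|x|^(alpha/2) |y|^(alpha/2)). With Q x y = K x y * v x * v y and
   u = phi / v, Tonelli gives that Q x y * (u x)^2 has double integral C * |phi|_2^2, and the
   theorem is the integral of Q * (u x - u y)^2 = Q * (u x)^2 + Q * (u y)^2 - 2 * Q * u x * u y.
   For the composition rule, each power |z|^(-a) is written as a Gamma average of Gaussians
   exp (- s |z|^2); the space integral is then a Gaussian convolution, and s = t * w
   decouples the two remaining parameters into a Gamma and a Beta integral. *)

theory Submission
  imports Defs "HOL-Probability.Distributions"
begin

section \<open>Gamma, Gaussian and Beta integrals\<close>

lemma nn_integral_gamma_scaled: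
  fixes p c :: real
  assumes "0 < p" "0 < c"
  shows "(\<integral>\<^sup>+t. ennreal (indicator {0<..} t * t powr (p - 1) * exp (- (c * t))) \<partial>lborel)
    = ennreal (Gamma p / c powr p)"
proof -
  let ?I = "\<integral>\<^sup>+t. ennreal (indicator {0<..} t * t powr (p - 1) * exp (- (c * t))) \<partial>lborel"
  have "ennreal (Gamma p) =
      (\<integral>\<^sup>+t. ennreal (indicator {0..} t * t powr (p - 1) / exp t) \<partial>lborel)"
    using assms by (rule_tac Gamma_conv_nn_integral_real)
  also have "\<dots> = ennreal \<bar>c\<bar> *
      (\<integral>\<^sup>+t. ennreal (indicator {0..} (0 + c * t) * (0 + c * t) powr (p - 1) / exp (0 + c * t)) \<partial>lborel)"
    using assms by (intro nn_integral_real_affine) auto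
  \<comment> \<open>The change from a closed to an open half-line costs nothing even pointwise:
    \<open>0 powr (p - 1) = 0\<close>, so the integrand vanishes at the origin. Together with the
    Jacobian c, the factor \<open>c powr (p - 1)\<close> gives \<open>c powr p\<close>.\<close>
  also have "(\<integral>\<^sup>+t. ennreal (indicator {0..} (0 + c * t) * (0 + c * t) powr (p - 1) / exp (0 + c * t)) \<partial>lborel)
      = (\<integral>\<^sup>+t. ennreal (c powr (p - 1)) *
           ennreal (indicator {0<..} t * t powr (p - 1) * exp (- (c * t))) \<partial>lborel)"
    using assms
    by (intro nn_integral_cong)
       (auto simp: indicator_def powr_mult exp_minus field_simps zero_le_mult_iff
             simp flip: ennreal_mult)
  also have "\<dots> = ennreal (c powr (p - 1)) * ?I"
    by (intro nn_integral_cmult) auto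
  finally have *: "ennreal (Gamma p) = ennreal (c powr p) * ?I"
    using assms by (simp add: powr_diff mult.assoc[symmetric] flip: ennreal_mult)
  have "ennreal (Gamma p / c powr p) = ennreal (1 / c powr p) * ennreal (Gamma p)"
    using assms Gamma_real_pos[of p] by (simp flip: ennreal_mult)
  also have "\<dots> = ?I"
    unfolding * mult.assoc[symmetric] using assms by (simp flip: ennreal_mult)
  finally show ?thesis by simp
qed

text \<open>The integrand is \<open>sqrt (pi / c)\<close> times the centred normal density of
  variance 1 / (2c), which has total mass 1.\<close>

lemma nn_integral_gaussian_real:
  fixes c :: real
  assumes "0 < c"
  shows "(\<integral>\<^sup>+x. ennreal (exp (- (c * x\<^sup>2))) \<partial>lborel) = ennreal (sqrt (pi / c))"
proof -
  define \<sigma> where "\<sigma> = 1 / sqrt (2 * c)"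
  have \<sigma>: "0 < \<sigma>" "2 * \<sigma>\<^sup>2 = 1 / c"
    using assms by (auto simp: \<sigma>_def power_divide)
  have "exp (- (c * x\<^sup>2)) = sqrt (pi / c) * normal_density 0 \<sigma> x" for x
  proof -
    have "normal_density 0 \<sigma> x = 1 / sqrt (pi * (2 * \<sigma>\<^sup>2)) * exp (- (x\<^sup>2 / (2 * \<sigma>\<^sup>2)))"
      by (simp add: normal_density_def mult_ac)
    then show ?thesis
      unfolding \<sigma>(2) using assms by (simp add: mult.commute real_sqrt_divide)
  qed
  moreover have "(\<integral>\<^sup>+x. ennreal (normal_density 0 \<sigma> x) \<partial>lborel) = 1"
    using \<sigma> by (subst nn_integral_eq_integral) auto
  ultimately show ?thesis
    using assms by (simp add: ennreal_mult nn_integral_cmult)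
qed

text \<open>The Gaussian of the norm is the product of its one-dimensional Gaussians over
  \<open>Basis\<close>, and Lebesgue measure is a product measure.\<close>

lemma nn_integral_gaussian:
  fixes c :: real
  assumes "0 < c"
  shows "(\<integral>\<^sup>+x. ennreal (exp (- (c * (norm (x::'a::euclidean_space))\<^sup>2))) \<partial>lborel)
    = ennreal ((pi / c) powr (DIM('a) / 2))"
proof -
  have "exp (- (c * (norm x)\<^sup>2)) = (\<Prod>b\<in>Basis. exp (- (c * (x \<bullet> b)\<^sup>2)))" for x :: 'a
    unfolding power2_norm_eq_inner euclidean_inner[of x x]
    by (simp add: exp_sum[symmetric] sum_negf sum_distrib_left[symmetric] power2_eq_square)
  then have "(\<integral>\<^sup>+x. ennreal (exp (- (c * (norm (x::'a))\<^sup>2))) \<partial>lborel)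
     = (\<integral>\<^sup>+x. (\<Prod>b\<in>Basis. ennreal (exp (- (c * ((x::'a) \<bullet> b)\<^sup>2)))) \<partial>lborel)"
    by (simp add: prod_ennreal)
  also have "\<dots> = (\<Prod>b\<in>(Basis::'a set). ennreal (sqrt (pi / c)))"
    by (subst nn_integral_lborel_prod) (auto simp: nn_integral_gaussian_real assms)
  also have "\<dots> = ennreal ((pi / c) powr (DIM('a) / 2))"
    using assms by (simp add: ennreal_power powr_half_sqrt[symmetric] powr_realpow[symmetric] powr_powr)
  finally show ?thesis .
qed

text \<open>This is the Beta function B(p, q) written over the half-line. Replacing
  \<open>Gamma (p + q) / (1 + w) powr (p + q)\<close> by its Gamma integral in t and integrating
  over w first yields \<open>Gamma p / t powr p\<close>; this lowers the exponent p + q to q, so the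
  t-integral that is left is \<open>Gamma q\<close>.\<close>

lemma nn_integral_beta_prime:
  fixes p q :: real
  assumes "0 < p" "0 < q"
  shows "(\<integral>\<^sup>+w. ennreal (indicator {0<..} w * w powr (p - 1) / (1 + w) powr (p + q)) \<partial>lborel)
    = ennreal (Gamma p * Gamma q / Gamma (p + q))"
proof -
  let ?G = "\<lambda>p t::real. indicator {0<..} t * t powr (p - 1)"
  let ?I = "\<integral>\<^sup>+w. ennreal (?G p w / (1 + w) powr (p + q)) \<partial>lborel"
  have pos: "Gamma p > 0" "Gamma q > 0" "Gamma (p + q) > 0"
    using assms by (auto intro: Gamma_real_pos)
  have split: "exp (- ((1 + w) * t)) = exp (- t) * exp (- (t * w))" for t w :: real
    by (simp add: algebra_simps exp_add[symmetric])
  have split': "exp (- (t * (1 + w))) = exp (- t) * exp (- (t * w))" for t w :: real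
    by (simp add: algebra_simps exp_add[symmetric])
  have "ennreal (Gamma (p + q)) * ?I
      = (\<integral>\<^sup>+w. ennreal (?G p w) * ennreal (Gamma (p + q) / (1 + w) powr (p + q)) \<partial>lborel)"
    using assms by (subst nn_integral_cmult[symmetric])
      (auto intro!: nn_integral_cong simp: indicator_def simp flip: ennreal_mult)
  also have "\<dots> = (\<integral>\<^sup>+w. ennreal (?G p w) *
        (\<integral>\<^sup>+t. ennreal (?G (p + q) t * exp (- ((1 + w) * t))) \<partial>lborel) \<partial>lborel)"
  proof (intro nn_integral_cong)
    fix w :: real
    show "ennreal (?G p w) * ennreal (Gamma (p + q) / (1 + w) powr (p + q)) = ennreal (?G p w) *
        (\<integral>\<^sup>+t. ennreal (?G (p + q) t * exp (- ((1 + w) * t))) \<partial>lborel)"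
      using assms nn_integral_gamma_scaled[of "p + q" "1 + w"] by (cases "0 < w") auto
  qed
  also have "\<dots> = (\<integral>\<^sup>+w. \<integral>\<^sup>+t. ennreal (?G p w) * ennreal (?G (p + q) t * exp (- ((1 + w) * t)))
        \<partial>lborel \<partial>lborel)"
    by (subst nn_integral_cmult) auto
  also have "\<dots> = (\<integral>\<^sup>+t. \<integral>\<^sup>+w. ennreal (?G p w) * ennreal (?G (p + q) t * exp (- ((1 + w) * t)))
        \<partial>lborel \<partial>lborel)"
    by (intro lborel_pair.Fubini') measurable
  also have "\<dots> = (\<integral>\<^sup>+t. ennreal (?G (p + q) t * exp (- t)) *
        (\<integral>\<^sup>+w. ennreal (?G p w * exp (- (t * w))) \<partial>lborel) \<partial>lborel)"
    by (subst nn_integral_cmult[symmetric])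
       (auto intro!: nn_integral_cong simp: indicator_def split split' mult_ac simp flip: ennreal_mult)
  also have "\<dots> = (\<integral>\<^sup>+t. ennreal (Gamma p) * ennreal (?G q t * exp (- (1 * t))) \<partial>lborel)"
  proof (intro nn_integral_cong)
    fix t :: real
    show "ennreal (?G (p + q) t * exp (- t)) *
        (\<integral>\<^sup>+w. ennreal (?G p w * exp (- (t * w))) \<partial>lborel)
        = ennreal (Gamma p) * ennreal (?G q t * exp (- (1 * t)))"
      using assms nn_integral_gamma_scaled[of p t] Gamma_real_pos[of p]
      by (cases "0 < t") (auto simp: powr_add powr_diff field_simps simp flip: ennreal_mult)
  qed
  also have "\<dots> = ennreal (Gamma p) * ennreal (Gamma q / 1 powr q)"
    using assms nn_integral_gamma_scaled[of q 1] by (subst nn_integral_cmult) auto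
  finally have *: "ennreal (Gamma (p + q)) * ?I = ennreal (Gamma p * Gamma q)"
    using assms Gamma_real_pos[of p] Gamma_real_pos[of q] by (simp add: ennreal_mult)
  have "?I = ennreal (1 / Gamma (p + q)) * (ennreal (Gamma (p + q)) * ?I)"
    unfolding mult.assoc[symmetric] using pos by (simp flip: ennreal_mult)
  then show ?thesis
    unfolding * using pos by (simp flip: ennreal_mult)
qed


section \<open>Gaussian convolution and the composition of Riesz kernels\<close>

lemma nn_integral_lborel_translate:
  fixes f :: "'a::euclidean_space \<Rightarrow> ennreal"
  assumes [measurable]: "f \<in> borel_measurable borel"
  shows "(\<integral>\<^sup>+y. f y \<partial>lborel) = (\<integral>\<^sup>+y. f (c + y) \<partial>lborel)"
  by (subst lborel_distr_plus[of c, symmetric]) (simp add: nn_integral_distr)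

text \<open>Completing the square in y and translating to the new centre leaves a pure Gaussian with
  parameter s + t.\<close>

lemma nn_integral_gaussian_product:
  fixes s t :: real and x :: "'a::euclidean_space"
  assumes "0 < s" "0 < t"
  shows "(\<integral>\<^sup>+y. ennreal (exp (- (s * (norm (x - y))\<^sup>2 + t * (norm y)\<^sup>2))) \<partial>lborel)
    = ennreal ((pi / (s + t)) powr (DIM('a) / 2) * exp (- (s * t / (s + t) * (norm x)\<^sup>2)))"
proof -
  \<comment> \<open>As a function of y the exponent
    \<open>s * (norm (x - y))\<^sup>2 + t * (norm y)\<^sup>2\<close> is smallest at
    \<open>r *\<^sub>R x\<close>, with minimum \<open>k * (norm x)\<^sup>2\<close>. The balance
    \<open>s * (1 - r) = t * r\<close> is what removes the cross term below.\<close>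
  define r where "r = s / (s + t)"
  define k where "k = s * t / (s + t)"
  have r: "s * (1 - r) = k" "t * r = k" "s + t > 0"
    using assms by (auto simp: r_def k_def field_simps)
  have r2: "s * (1 - r) ^ 2 + t * r ^ 2 = k"
    using r by (simp add: power2_eq_square mult.assoc[symmetric]) (simp add: algebra_simps)
  have square: "s * (norm (x - (r *\<^sub>R x + y)))\<^sup>2 + t * (norm (r *\<^sub>R x + y))\<^sup>2
      = k * (norm x)\<^sup>2 + (s + t) * (norm y)\<^sup>2" for y
  proof -
    have "s * (norm (x - (r *\<^sub>R x + y)))\<^sup>2 + t * (norm (r *\<^sub>R x + y))\<^sup>2
        = (s * (1 - r) ^ 2 + t * r ^ 2) * (x \<bullet> x) + 2 * (t * r - s * (1 - r)) * (x \<bullet> y)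
          + (s + t) * (y \<bullet> y)"
      unfolding power2_norm_eq_inner
      by (simp add: inner_simps inner_commute[of y x] power2_eq_square algebra_simps)
    then show ?thesis
      unfolding r2 r by (simp add: power2_norm_eq_inner)
  qed
  have "(\<integral>\<^sup>+y. ennreal (exp (- (s * (norm (x - y))\<^sup>2 + t * (norm y)\<^sup>2))) \<partial>lborel)
      = (\<integral>\<^sup>+y. ennreal (exp (- (k * (norm x)\<^sup>2))) * ennreal (exp (- ((s + t) * (norm (y::'a))\<^sup>2))) \<partial>lborel)"
    by (subst nn_integral_lborel_translate[where c = "r *\<^sub>R x"])
       (auto simp: square exp_add[symmetric] simp del: exp_add simp flip: ennreal_mult)
  also have "\<dots> = ennreal (exp (- (k * (norm x)\<^sup>2))) * ennreal ((pi / (s + t)) powr (DIM('a) / 2))"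
    using r by (simp add: nn_integral_cmult nn_integral_gaussian)
  finally show ?thesis
    by (simp add: k_def mult.commute ennreal_mult)
qed

text \<open>Writes a negative power of the norm as a mixture of Gaussians: the scaled Gamma integral
  with p = a / 2 and c the squared norm, which is positive because z is nonzero.\<close>

lemma nn_integral_gamma_norm:
  fixes z :: "'a::real_normed_vector"
  assumes "0 < a" "z \<noteq> 0"
  shows "(\<integral>\<^sup>+t. ennreal (indicator {0<..} t * t powr (a / 2 - 1) * exp (- (t * (norm z)\<^sup>2))) \<partial>lborel)
    = ennreal (Gamma (a / 2) / norm z powr a)"
proof -
  have "((norm z)\<^sup>2) powr (a / 2) = norm z powr a"
    using assms by (simp add: powr_realpow[symmetric] powr_powr del: powr_numeral)
  then show ?thesis
    using nn_integral_gamma_scaled[of "a / 2" "(norm z)\<^sup>2"] assms by (simp add: mult.commute)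
qed

text \<open>The bounds a < n and b < n control the singularities at x and at 0, and n < a + b the
  decay at infinity. In the computation they appear as positivity of the two Beta parameters and of
  the parameter \<open>?c\<close> of the last Gamma integral.\<close>

lemma nn_integral_riesz_composition:
  fixes x :: "'a::euclidean_space" and a b :: real
  defines "n \<equiv> real DIM('a)"
  assumes a: "0 < a" "a < n" and b: "0 < b" "b < n" and ab: "n < a + b" and x: "x \<noteq> 0"
  shows "(\<integral>\<^sup>+y. ennreal (1 / (norm (x - y) powr a * norm y powr b)) \<partial>lborel)
    = ennreal (pi powr (n / 2) *
        (Gamma ((n - a) / 2) * Gamma ((n - b) / 2) * Gamma ((a + b - n) / 2))
        / (Gamma (a / 2) * Gamma (b / 2) * Gamma ((2 * n - a - b) / 2)) / norm x powr (a + b - n))"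
proof -
  let ?G = "\<lambda>p t::real. indicator {0<..} t * t powr (p - 1)"
  let ?E = "\<lambda>s t y. exp (- (s * (norm (x - y))\<^sup>2 + t * (norm y)\<^sup>2))"
  let ?H = "\<lambda>s t. ?G (a / 2) s * ?G (b / 2) t *
      ((pi / (s + t)) powr (n / 2) * exp (- (s * t / (s + t) * (norm x)\<^sup>2)))"
  let ?J = "\<lambda>w. ?G (a / 2) w * pi powr (n / 2) / (1 + w) powr (n / 2)"
  let ?c = "(a + b - n) / 2"
  let ?K = "\<lambda>w t. ?J w * (?G ?c t * exp (- (t * (w / (1 + w) * (norm x)\<^sup>2))))"
  \<comment> \<open>P collects the Gamma factors of the two mixture representations; it is divided
    out at the end.\<close>
  define P where "P = Gamma (a / 2) * Gamma (b / 2)"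
  have P: "P > 0" unfolding P_def using a b by (intro mult_pos_pos Gamma_real_pos) auto
  have "ennreal P * (\<integral>\<^sup>+y. ennreal (1 / (norm (x - y) powr a * norm y powr b)) \<partial>lborel)
      = (\<integral>\<^sup>+y. ennreal (P * (1 / (norm (x - y) powr a * norm y powr b))) \<partial>lborel)"
    using P by (subst nn_integral_cmult[symmetric]) (auto simp flip: ennreal_mult)
  also have "\<dots> = (\<integral>\<^sup>+y. \<integral>\<^sup>+t. \<integral>\<^sup>+s. ennreal (?G (a / 2) s * ?G (b / 2) t * ?E s t y) \<partial>lborel \<partial>lborel \<partial>lborel)"
  proof (rule nn_integral_cong_AE)
    \<comment> \<open>The mixture representations need x - y and y to be nonzero, which excludes
      only two points.\<close>
    have "AE y in lborel. y \<noteq> x \<and> y \<noteq> 0"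
      using AE_lborel_singleton[of x] AE_lborel_singleton[of "0::'a"] by eventually_elim auto
    then show "AE y in lborel. ennreal (P * (1 / (norm (x - y) powr a * norm y powr b)))
      = (\<integral>\<^sup>+t. \<integral>\<^sup>+s. ennreal (?G (a / 2) s * ?G (b / 2) t * ?E s t y) \<partial>lborel \<partial>lborel)"
    proof eventually_elim
      fix y :: 'a assume y: "y \<noteq> x \<and> y \<noteq> 0"
      let ?f = "\<lambda>s. ennreal (?G (a / 2) s * exp (- (s * (norm (x - y))\<^sup>2)))"
      let ?g = "\<lambda>t. ennreal (?G (b / 2) t * exp (- (t * (norm y)\<^sup>2)))"
      have "(\<integral>\<^sup>+t. \<integral>\<^sup>+s. ennreal (?G (a / 2) s * ?G (b / 2) t * ?E s t y) \<partial>lborel \<partial>lborel)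
          = (\<integral>\<^sup>+t. \<integral>\<^sup>+s. ?f s * ?g t \<partial>lborel \<partial>lborel)"
        by (intro nn_integral_cong) (auto simp: indicator_def exp_diff exp_minus field_simps simp flip: ennreal_mult)
      also have "\<dots> = (\<integral>\<^sup>+s. ?f s \<partial>lborel) * (\<integral>\<^sup>+t. ?g t \<partial>lborel)"
        by (simp add: nn_integral_multc nn_integral_cmult)
      also have "\<dots> = ennreal (Gamma (a / 2) / norm (x - y) powr a) * ennreal (Gamma (b / 2) / norm y powr b)"
        using y a b by (intro arg_cong2[where f = "(*)"] nn_integral_gamma_norm) auto
      also have "\<dots> = ennreal (P * (1 / (norm (x - y) powr a * norm y powr b)))"
        using a b Gamma_real_pos[of "a / 2"] Gamma_real_pos[of "b / 2"]
        by (simp add: P_def flip: ennreal_mult)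
      finally show "ennreal (P * (1 / (norm (x - y) powr a * norm y powr b)))
        = (\<integral>\<^sup>+t. \<integral>\<^sup>+s. ennreal (?G (a / 2) s * ?G (b / 2) t * ?E s t y) \<partial>lborel \<partial>lborel)" ..
    qed
  qed
  \<comment> \<open>Two applications of Tonelli move the space variable y innermost, where the
    integral is a Gaussian convolution.\<close>
  also have "\<dots> = (\<integral>\<^sup>+t. \<integral>\<^sup>+y. \<integral>\<^sup>+s. ennreal (?G (a / 2) s * ?G (b / 2) t * ?E s t y) \<partial>lborel \<partial>lborel \<partial>lborel)"
    by (intro lborel_pair.Fubini') measurable
  also have "\<dots> = (\<integral>\<^sup>+t. \<integral>\<^sup>+s. \<integral>\<^sup>+y. ennreal (?G (a / 2) s * ?G (b / 2) t * ?E s t y) \<partial>lborel \<partial>lborel \<partial>lborel)"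
    by (intro nn_integral_cong lborel_pair.Fubini') measurable
  also have "\<dots> = (\<integral>\<^sup>+t. \<integral>\<^sup>+s. ennreal (?H s t) \<partial>lborel \<partial>lborel)"
  proof (intro nn_integral_cong)
    fix s t :: real
    show "(\<integral>\<^sup>+y. ennreal (?G (a / 2) s * ?G (b / 2) t * ?E s t y) \<partial>lborel) = ennreal (?H s t)"
    proof (cases "0 < s \<and> 0 < t")
      case True
      then have "(\<integral>\<^sup>+y. ennreal (?G (a / 2) s * ?G (b / 2) t * ?E s t y) \<partial>lborel)
          = ennreal (?G (a / 2) s * ?G (b / 2) t) * (\<integral>\<^sup>+y. ennreal (?E s t y) \<partial>lborel)"
        by (subst nn_integral_cmult[symmetric]) (auto simp flip: ennreal_mult)
      also have "(\<integral>\<^sup>+y. ennreal (?E s t y) \<partial>lborel)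
          = ennreal ((pi / (s + t)) powr (n / 2) * exp (- (s * t / (s + t) * (norm x)\<^sup>2)))"
        unfolding n_def using True by (intro nn_integral_gaussian_product) auto
      finally show ?thesis
        using True by (simp flip: ennreal_mult)
    qed (auto simp: indicator_def)
  qed
  \<comment> \<open>Substituting s = t w turns s t / (s + t) into t w / (1 + w), which is linear in
    t, so the t-integral becomes a Gamma integral.\<close>
  also have "\<dots> = (\<integral>\<^sup>+t. \<integral>\<^sup>+w. ennreal (?K w t) \<partial>lborel \<partial>lborel)"
  proof (rule nn_integral_cong)
    fix t :: real
    show "(\<integral>\<^sup>+s. ennreal (?H s t) \<partial>lborel) = (\<integral>\<^sup>+w. ennreal (?K w t) \<partial>lborel)"
    proof (cases "0 < t")
      case True
      have "(\<integral>\<^sup>+s. ennreal (?H s t) \<partial>lborel) = ennreal \<bar>t\<bar> * (\<integral>\<^sup>+w. ennreal (?H (0 + t * w) t) \<partial>lborel)"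
        using True by (intro nn_integral_real_affine) auto
      also have "\<dots> = (\<integral>\<^sup>+w. ennreal (t * ?H (t * w) t) \<partial>lborel)"
        using True by (subst nn_integral_cmult[symmetric]) (auto simp flip: ennreal_mult)
      also have "\<dots> = (\<integral>\<^sup>+w. ennreal (?K w t) \<partial>lborel)"
      proof (intro nn_integral_cong)
        fix w :: real
        have "t * ?H (t * w) t = ?K w t"
        proof (cases "0 < w")
          case w: True
          have 1: "t * w * t / (t * w + t) * (norm x)\<^sup>2 = t * (w / (1 + w) * (norm x)\<^sup>2)"
          proof -
            have "t * w + t = t * (1 + w)" by (simp add: algebra_simps)
            then show ?thesis using w True by simp
          qed
          have 2: "(pi / (t * w + t)) powr (n / 2) = pi powr (n / 2) / (1 + w) powr (n / 2) / t powr (n / 2)"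
            using w True by (simp add: powr_divide[symmetric] powr_mult[symmetric] algebra_simps)
          \<comment> \<open>The leading t is the Jacobian of s = t w. The total exponent is 1 + (a/2
            - 1) + (b/2 - 1) - n/2, the exponent of a Gamma integral with parameter
            \<open>?c\<close>.\<close>
          have 3: "t * (t powr (a / 2 - 1) * t powr (b / 2 - 1) / t powr (n / 2)) = t powr (?c - 1)"
          proof -
            have "t powr 1 * (t powr (a / 2 - 1) * t powr (b / 2 - 1) / t powr (n / 2))
                = t powr (1 + ((a / 2 - 1) + (b / 2 - 1) - n / 2))"
              by (simp only: powr_add powr_diff)
            also have "1 + ((a / 2 - 1) + (b / 2 - 1) - n / 2) = ?c - 1"
              by (simp add: field_simps)
            finally show ?thesis using True by simp
          qed
          have "t * ?H (t * w) t = (w powr (a / 2 - 1) * pi powr (n / 2) / (1 + w) powr (n / 2))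
              * ((t * (t powr (a / 2 - 1) * t powr (b / 2 - 1) / t powr (n / 2)))
              * exp (- (t * (w / (1 + w) * (norm x)\<^sup>2))))"
            unfolding 1 2 using w True by (simp add: powr_mult)
          then show ?thesis
            unfolding 3 using w True by simp
        qed (use True in \<open>auto simp: indicator_def zero_less_mult_iff\<close>)
        then show "ennreal (t * ?H (t * w) t) = ennreal (?K w t)"
          by (rule arg_cong)
      qed
      finally show ?thesis .
    qed (auto simp: indicator_def)
  qed
  also have "\<dots> = (\<integral>\<^sup>+w. \<integral>\<^sup>+t. ennreal (?K w t) \<partial>lborel \<partial>lborel)"
    by (intro lborel_pair.Fubini') measurable
  \<comment> \<open>The t-integral has rate \<open>w / (1 + w) * (norm x)\<^sup>2\<close>; its power
    \<open>?c\<close> supplies the dependence on x and shifts the exponents of w and 1 + w to those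
    of a Beta integral with parameters (n - b)/2 and (n - a)/2.\<close>
  also have "\<dots> = (\<integral>\<^sup>+w. ennreal (pi powr (n / 2) * Gamma ?c / norm x powr (a + b - n)) *
      ennreal (?G ((n - b) / 2) w / (1 + w) powr ((n - b) / 2 + (n - a) / 2)) \<partial>lborel)"
  proof (intro nn_integral_cong)
    fix w :: real
    show "(\<integral>\<^sup>+t. ennreal (?K w t) \<partial>lborel) = ennreal (pi powr (n / 2) * Gamma ?c / norm x powr (a + b - n)) *
      ennreal (?G ((n - b) / 2) w / (1 + w) powr ((n - b) / 2 + (n - a) / 2))"
    proof (cases "0 < w")
      case w: True
      have c: "?c > 0" "Gamma ?c > 0" using ab by (auto intro: Gamma_real_pos)
      have k: "w / (1 + w) * (norm x)\<^sup>2 > 0" using w x by auto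
      have "(\<integral>\<^sup>+t. ennreal (?K w t) \<partial>lborel) = ennreal (?J w) *
          (\<integral>\<^sup>+t. ennreal (?G ?c t * exp (- (w / (1 + w) * (norm x)\<^sup>2 * t))) \<partial>lborel)"
        using w by (subst nn_integral_cmult[symmetric])
          (auto intro!: nn_integral_cong simp: mult_ac simp flip: ennreal_mult)
      also have "\<dots> = ennreal (?J w * (Gamma ?c / (w / (1 + w) * (norm x)\<^sup>2) powr ?c))"
        unfolding nn_integral_gamma_scaled[OF c(1) k]
        using w c by (intro ennreal_mult[symmetric]) auto
      also have "(w / (1 + w) * (norm x)\<^sup>2) powr ?c = w powr ?c / (1 + w) powr ?c * norm x powr (a + b - n)"
      proof -
        have "((norm x)\<^sup>2) powr ?c = norm x powr (2 * ?c)"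
          using x by (simp add: powr_realpow[symmetric] powr_powr del: powr_numeral)
        also have "2 * ?c = a + b - n" by simp
        finally show ?thesis using w by (simp add: powr_mult powr_divide)
      qed
      also have "?J w * (Gamma ?c / (w powr ?c / (1 + w) powr ?c * norm x powr (a + b - n)))
         = (pi powr (n / 2) * Gamma ?c / norm x powr (a + b - n)) *
           (w powr (a / 2 - 1) / w powr ?c / ((1 + w) powr (n / 2) / (1 + w) powr ?c))"
        using w by (simp add: mult_ac)
      also have "w powr (a / 2 - 1) / w powr ?c = w powr ((n - b) / 2 - 1)"
      proof -
        have "a / 2 - 1 - ?c = (n - b) / 2 - 1" by (simp add: field_simps)
        then show ?thesis by (simp only: powr_diff[symmetric])
      qed
      also have "(1 + w) powr (n / 2) / (1 + w) powr ?c = (1 + w) powr ((n - b) / 2 + (n - a) / 2)"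
      proof -
        have "n / 2 - ?c = (n - b) / 2 + (n - a) / 2" by (simp add: field_simps)
        then show ?thesis by (simp only: powr_diff[symmetric])
      qed
      finally show ?thesis
        using w c by (simp flip: ennreal_mult)
    qed (auto simp: indicator_def)
  qed
  also have "\<dots> = ennreal (pi powr (n / 2) * Gamma ?c / norm x powr (a + b - n)) *
      ennreal (Gamma ((n - b) / 2) * Gamma ((n - a) / 2) / Gamma ((n - b) / 2 + (n - a) / 2))"
    using a b by (subst nn_integral_cmult) (auto simp: nn_integral_beta_prime)
  also have "\<dots> = ennreal (pi powr (n / 2) * Gamma ?c / norm x powr (a + b - n) *
      (Gamma ((n - b) / 2) * Gamma ((n - a) / 2) / Gamma ((n - b) / 2 + (n - a) / 2)))"
    using a b ab
    by (intro ennreal_mult[symmetric] mult_nonneg_nonneg divide_nonneg_nonneg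
        less_imp_le[OF Gamma_real_pos]) (auto intro!: add_pos_pos)
  finally have *: "ennreal P * (\<integral>\<^sup>+y. ennreal (1 / (norm (x - y) powr a * norm y powr b)) \<partial>lborel)
      = ennreal (pi powr (n / 2) * Gamma ?c / norm x powr (a + b - n) *
      (Gamma ((n - b) / 2) * Gamma ((n - a) / 2) / Gamma ((n - b) / 2 + (n - a) / 2)))"
    (is "_ = ennreal ?R") .
  have "0 \<le> ?R"
    using a b ab by (intro mult_nonneg_nonneg divide_nonneg_nonneg less_imp_le[OF Gamma_real_pos]) (auto intro!: add_pos_pos)
  have "(\<integral>\<^sup>+y. ennreal (1 / (norm (x - y) powr a * norm y powr b)) \<partial>lborel) = ennreal (1 / P) *
      (ennreal P * (\<integral>\<^sup>+y. ennreal (1 / (norm (x - y) powr a * norm y powr b)) \<partial>lborel))"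
    unfolding mult.assoc[symmetric] using P by (simp flip: ennreal_mult)
  also have "\<dots> = ennreal (1 / P * ?R)"
    unfolding * using P \<open>0 \<le> ?R\<close> by (simp flip: ennreal_mult)
  also have "(n - b) / 2 + (n - a) / 2 = (2 * n - a - b) / 2"
    by (simp add: field_simps)
  finally show ?thesis
    by (simp add: P_def mult_ac)
qed


section \<open>The power eigenfunction and the quadratic form identity\<close>

lemma sigma_finite_lebesgue: "sigma_finite_measure (lebesgue :: 'a::euclidean_space measure)"
proof
  obtain A :: "'a set set" where "countable A" "A \<subseteq> sets lborel" "\<Union>A = space lborel"
      "\<forall>a\<in>A. emeasure lborel a \<noteq> \<infinity>"
    using lborel.sigma_finite_countable by blast
  then show "\<exists>A. countable A \<and> A \<subseteq> sets (lebesgue :: 'a measure) \<and> \<Union>A = space lebesgue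
      \<and> (\<forall>a\<in>A. emeasure lebesgue a \<noteq> \<infinity>)"
    by (intro exI[of _ A]) (auto simp: subset_eq)
qed

text \<open>The composition rule with a = N - \<alpha> and b = (N + \<alpha>)/2. Multiplied by
  \<open>norm x powr (- \<alpha> / 2)\<close>, it is the eigenfunction equation for the power -N/2
  of the norm.\<close>

lemma nn_integral_riesz_potential:
  fixes \<alpha> :: real and x :: "real ^ 'n"
  assumes "0 < \<alpha>" "\<alpha> < real CARD('n)" and x: "x \<noteq> 0"
  shows "(\<integral>\<^sup>+y. ennreal (riesz_potential \<alpha> (x - y) / norm y powr ((real CARD('n) + \<alpha>) / 2)) \<partial>lebesgue)
    = ennreal (sharp_const CARD('n) \<alpha> / norm x powr ((real CARD('n) - \<alpha>) / 2))"
proof -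
  define n where "n = real CARD('n)"
  define A where "A = riesz_const CARD('n) \<alpha>"
  have n: "0 < \<alpha>" "\<alpha> < n" using assms by (auto simp: n_def)
  have pos: "Gamma ((n - \<alpha>) / 2) > 0" "Gamma (\<alpha> / 2) > 0" "Gamma ((n - \<alpha>) / 4) > 0" "Gamma ((n + \<alpha>) / 4) > 0"
    using n by (auto intro!: Gamma_real_pos)
  have A: "A = Gamma ((n - \<alpha>) / 2) / (2 powr \<alpha> * pi powr (n / 2) * Gamma (\<alpha> / 2))"
    by (simp add: A_def riesz_const_def n_def)
  then have "A > 0" using pos by simp
  \<comment> \<open>For these a and b the arguments of the Gamma factors coincide in pairs, which
    produces the square in \<open>sharp_const\<close>. The remaining Gamma factors and the power of
    pi cancel against \<open>riesz_const\<close>, leaving only \<open>2 powr \<alpha>\<close> in the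
    denominator.\<close>
  have args: "(n - (n - \<alpha>)) / 2 = \<alpha> / 2" "(n - (n + \<alpha>) / 2) / 2 = (n - \<alpha>) / 4"
      "((n - \<alpha>) + (n + \<alpha>) / 2 - n) / 2 = (n - \<alpha>) / 4" "(n + \<alpha>) / 2 / 2 = (n + \<alpha>) / 4"
      "(2 * n - (n - \<alpha>) - (n + \<alpha>) / 2) / 2 = (n + \<alpha>) / 4"
      "(n - \<alpha>) + (n + \<alpha>) / 2 - n = (n - \<alpha>) / 2"
    by (auto simp: field_simps)
  have "(\<integral>\<^sup>+y. ennreal (riesz_potential \<alpha> (x - y) / norm y powr ((n + \<alpha>) / 2)) \<partial>lebesgue)
      = (\<integral>\<^sup>+y. ennreal A * ennreal (1 / (norm (x - y) powr (n - \<alpha>) * norm y powr ((n + \<alpha>) / 2))) \<partial>lborel)"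
    unfolding nn_integral_completion riesz_potential_def A_def[symmetric] n_def[symmetric]
    using \<open>A > 0\<close> by (intro nn_integral_cong) (simp flip: ennreal_mult)
  also have "\<dots> = ennreal A * (\<integral>\<^sup>+y. ennreal (1 / (norm (x - y) powr (n - \<alpha>) * norm y powr ((n + \<alpha>) / 2))) \<partial>lborel)"
    by (rule nn_integral_cmult) measurable
  also have "\<dots> = ennreal A * ennreal (pi powr (n / 2) *
        (Gamma (\<alpha> / 2) * Gamma ((n - \<alpha>) / 4) * Gamma ((n - \<alpha>) / 4))
        / (Gamma ((n - \<alpha>) / 2) * Gamma ((n + \<alpha>) / 4) * Gamma ((n + \<alpha>) / 4)) / norm x powr ((n - \<alpha>) / 2))"
    using nn_integral_riesz_composition[of "n - \<alpha>" "(n + \<alpha>) / 2" x] x n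
    by (simp only: DIM_cart DIM_real mult_1_right n_def[symmetric] args) auto
  also have "\<dots> = ennreal (sharp_const CARD('n) \<alpha> / norm x powr ((n - \<alpha>) / 2))"
    using pos \<open>A > 0\<close>
    by (simp add: sharp_const_def n_def[symmetric] A power_divide power2_eq_square flip: ennreal_mult)
  finally show ?thesis unfolding n_def .
qed

text \<open>Integrability on the product space is part of the conclusion because a Bochner integral
  defaults to 0 on non-integrable functions, so the equation alone would not express that the double
  integrals converge.\<close>

theorem theoremA:
  fixes \<alpha> :: real and \<phi> :: "real ^ 'n \<Rightarrow> real"
  assumes "0 < \<alpha>" and "\<alpha> < real CARD('n)"
    and "\<phi> \<in> L2"
  shows "integrable (lebesgue \<Otimes>\<^sub>M lebesgue) (\<lambda>(x, y). riesz_integrand \<alpha> \<phi> x y)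
    \<and> integrable (lebesgue \<Otimes>\<^sub>M lebesgue) (\<lambda>(x, y). remainder_integrand \<alpha> \<phi> x y)
    \<and> sharp_const CARD('n) \<alpha> * (LINT x|lebesgue. \<bar>\<phi> x\<bar>\<^sup>2)
      = (LINT y|lebesgue. LINT x|lebesgue. riesz_integrand \<alpha> \<phi> x y)
        + 1 / 2 * (LINT y|lebesgue. LINT x|lebesgue. remainder_integrand \<alpha> \<phi> x y)"
proof -
  define n where "n = real CARD('n)"
  define C where "C = sharp_const CARD('n) \<alpha>"
  define Q where "Q = (\<lambda>x y :: real ^ 'n. riesz_potential \<alpha> (x - y)
    / (norm x powr ((n + \<alpha>) / 2) * norm y powr ((n + \<alpha>) / 2)))"
  \<comment> \<open>Multiplying by the power N/2 instead of dividing by v avoids a division at the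
    origin.\<close>
  define u where "u = (\<lambda>x. \<phi> x * norm x powr (n / 2))"
  define W where "W = (\<lambda>x y. Q x y * (u x)\<^sup>2)"
  let ?M = "lebesgue :: (real ^ 'n) measure"
  \<comment> \<open>Sigma-finiteness of the completed measure is what Tonelli and Fubini require on
    this product.\<close>
  interpret L: sigma_finite_measure ?M by (rule sigma_finite_lebesgue)
  interpret LP: pair_sigma_finite ?M ?M ..
  have n: "0 < \<alpha>" "\<alpha> < n" using assms by (auto simp: n_def)
  have \<phi>: "\<phi> \<in> borel_measurable ?M" "integrable ?M (\<lambda>x. (\<phi> x)\<^sup>2)"
    using assms(3) by (auto simp: L2_def)
  have C: "0 \<le> C" by (simp add: C_def sharp_const_def)
  have potential_nonneg: "0 \<le> riesz_potential \<alpha> z" for z :: "real ^ 'n"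
    unfolding riesz_potential_def riesz_const_def n_def[symmetric] using n
    by (intro divide_nonneg_nonneg mult_nonneg_nonneg less_imp_le[OF Gamma_real_pos]) auto
  have Q_nonneg: "0 \<le> Q x y" for x y by (simp add: Q_def potential_nonneg)
  have Q_sym: "Q x y = Q y x" for x y
    by (simp add: Q_def riesz_potential_def norm_minus_commute mult.commute)

  \<comment> \<open>Since \<phi> is only Lebesgue measurable, the product carries the Lebesgue
    sigma-algebra in each factor. The projections become Borel measurable through the identity,
    which gives access to norms and differences.\<close>
  have borel: "(\<lambda>x. x) \<in> borel_measurable ?M"
    using id_borel_measurable_lebesgue by (simp add: id_def)
  have [measurable]: "fst \<in> borel_measurable (?M \<Otimes>\<^sub>M ?M)" "snd \<in> borel_measurable (?M \<Otimes>\<^sub>M ?M)"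
    by (rule measurable_compose[OF measurable_fst borel] measurable_compose[OF measurable_snd borel])+
  have [measurable]: "(\<lambda>p. \<phi> (fst p)) \<in> borel_measurable (?M \<Otimes>\<^sub>M ?M)"
      "(\<lambda>p. \<phi> (snd p)) \<in> borel_measurable (?M \<Otimes>\<^sub>M ?M)"
    by (rule measurable_compose[OF measurable_fst \<phi>(1)] measurable_compose[OF measurable_snd \<phi>(1)])+
  have [measurable]: "(\<lambda>p. Q (fst p) (snd p)) \<in> borel_measurable (?M \<Otimes>\<^sub>M ?M)"
    unfolding Q_def riesz_potential_def by measurable
  have [measurable]: "(\<lambda>p. u (fst p)) \<in> borel_measurable (?M \<Otimes>\<^sub>M ?M)"
      "(\<lambda>p. u (snd p)) \<in> borel_measurable (?M \<Otimes>\<^sub>M ?M)"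
    unfolding u_def by measurable

  have riesz: "riesz_integrand \<alpha> \<phi> x y = Q x y * (u x * u y)" for x y
  proof -
    \<comment> \<open>At the origin both sides are 0, by \<open>0 powr a = 0\<close> and division by
      zero; hence the factorisation holds at every point.\<close>
    have *: "norm z powr (n / 2) / norm z powr ((n + \<alpha>) / 2) = 1 / norm z powr (\<alpha> / 2)" for z :: "real ^ 'n"
      by (cases "z = 0") (auto simp: add_divide_distrib powr_add)
    have "Q x y * (u x * u y) = riesz_potential \<alpha> (x - y) * \<phi> x * \<phi> y
        * (norm x powr (n / 2) / norm x powr ((n + \<alpha>) / 2)) * (norm y powr (n / 2) / norm y powr ((n + \<alpha>) / 2))"
      by (simp add: Q_def u_def)
    then show ?thesis
      unfolding * by (simp add: riesz_integrand_def)
  qed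
  have remainder: "remainder_integrand \<alpha> \<phi> x y = Q x y * (u x - u y)\<^sup>2" for x y
    by (simp add: remainder_integrand_def Q_def u_def n_def)

  \<comment> \<open>With x fixed, the y-integral is the eigenfunction equation:
    \<open>(u x)\<^sup>2\<close> and the weight at x leave the power n - (n + \<alpha>)/2 = (n -
    \<alpha>)/2 of the norm, which cancels the power in the eigenfunction equation.\<close>
  have inner: "(\<integral>\<^sup>+y. ennreal (W x y) \<partial>?M) = ennreal (C * (\<phi> x)\<^sup>2)" if "x \<noteq> 0" for x
  proof -
    have W: "W x y = ((\<phi> x)\<^sup>2 * norm x powr ((n - \<alpha>) / 2)) * (riesz_potential \<alpha> (x - y) / norm y powr ((n + \<alpha>) / 2))" for y
    proof -
      have "(norm x powr (n / 2))\<^sup>2 / norm x powr ((n + \<alpha>) / 2) = norm x powr ((n - \<alpha>) / 2)"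
        unfolding power2_eq_square using that by (simp add: field_simps flip: powr_add)
      then show ?thesis
        by (simp add: W_def Q_def u_def power_mult_distrib flip: \<open>_ = norm x powr ((n - \<alpha>) / 2)\<close>)
    qed
    have "(\<integral>\<^sup>+y. ennreal (W x y) \<partial>?M) = ennreal ((\<phi> x)\<^sup>2 * norm x powr ((n - \<alpha>) / 2)) *
        (\<integral>\<^sup>+y. ennreal (riesz_potential \<alpha> (x - y) / norm y powr ((n + \<alpha>) / 2)) \<partial>?M)"
    proof -
      have "(\<lambda>y. ennreal (riesz_potential \<alpha> (x - y) / norm y powr ((n + \<alpha>) / 2))) \<in> borel_measurable lborel"
        unfolding riesz_potential_def by measurable
      then show ?thesis
        unfolding W nn_integral_completion
        by (subst nn_integral_cmult[symmetric])
           (auto intro!: nn_integral_cong ennreal_mult simp: potential_nonneg simp del: times_divide_eq_right)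
    qed
    also have "\<dots> = ennreal ((\<phi> x)\<^sup>2 * norm x powr ((n - \<alpha>) / 2)) * ennreal (C / norm x powr ((n - \<alpha>) / 2))"
      unfolding n_def C_def using that assms by (subst nn_integral_riesz_potential) auto
    also have "\<dots> = ennreal (C * (\<phi> x)\<^sup>2)"
      using C that by (simp flip: ennreal_mult)
    finally show ?thesis .
  qed
  have "(\<integral>\<^sup>+p. ennreal (W (fst p) (snd p)) \<partial>(?M \<Otimes>\<^sub>M ?M)) = (\<integral>\<^sup>+x. \<integral>\<^sup>+y. ennreal (W x y) \<partial>?M \<partial>?M)"
    unfolding W_def by (subst L.nn_integral_fst[symmetric]) auto
  also have "\<dots> = (\<integral>\<^sup>+x. ennreal (C * (\<phi> x)\<^sup>2) \<partial>?M)"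
  proof (rule nn_integral_cong_AE)
    show "AE x in ?M. (\<integral>\<^sup>+y. ennreal (W x y) \<partial>?M) = ennreal (C * (\<phi> x)\<^sup>2)"
      using AE_completion[OF AE_lborel_singleton[of 0]] by eventually_elim (rule inner)
  qed
  also have "\<dots> = ennreal (C * (LINT x|?M. (\<phi> x)\<^sup>2))"
    using C \<phi> by (subst nn_integral_eq_integral) auto
  \<comment> \<open>As W is nonnegative, the finite value found by Tonelli yields integrability and
    the Bochner integral at once.\<close>
  finally have W: "integrable (?M \<Otimes>\<^sub>M ?M) (\<lambda>p. W (fst p) (snd p))
      \<and> (LINT p|(?M \<Otimes>\<^sub>M ?M). W (fst p) (snd p)) = C * (LINT x|?M. (\<phi> x)\<^sup>2)"
    using C Q_nonneg by (subst (asm) nn_integral_eq_integrable) (auto simp: W_def)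
  \<comment> \<open>Swapping coordinates handles the term with \<open>(u y)\<^sup>2\<close>, by
    symmetry of Q.\<close>
  have W': "integrable (?M \<Otimes>\<^sub>M ?M) (\<lambda>p. W (snd p) (fst p))"
    using LP.integrable_product_swap[of "\<lambda>p. W (fst p) (snd p)"] W by (simp add: case_prod_beta')
  have W'_eq: "(LINT p|(?M \<Otimes>\<^sub>M ?M). W (snd p) (fst p)) = C * (LINT x|?M. (\<phi> x)\<^sup>2)"
    using LP.integral_product_swap[of "\<lambda>p. W (fst p) (snd p)"] W
      borel_measurable_integrable[OF conjunct1[OF W]]
    by (simp add: case_prod_beta')

  \<comment> \<open>Domination by \<open>W x y + W y x\<close>, from the bound of a product by the
    sum of squares, makes the cross term integrable; only then may the expanded square be integrated
    term by term.\<close>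
  have R: "integrable (?M \<Otimes>\<^sub>M ?M) (\<lambda>p. riesz_integrand \<alpha> \<phi> (fst p) (snd p))"
  proof (rule Bochner_Integration.integrable_bound)
    show "integrable (?M \<Otimes>\<^sub>M ?M) (\<lambda>p. W (fst p) (snd p) + W (snd p) (fst p))"
      using W W' by simp
    show "(\<lambda>p. riesz_integrand \<alpha> \<phi> (fst p) (snd p)) \<in> borel_measurable (?M \<Otimes>\<^sub>M ?M)"
      unfolding riesz by measurable
    have "\<bar>riesz_integrand \<alpha> \<phi> x y\<bar> \<le> \<bar>W x y + W y x\<bar>" for x y
    proof -
      have "\<bar>u x * u y\<bar> \<le> (u x)\<^sup>2 + (u y)\<^sup>2"
        using sum_squares_bound[of "u x" "u y"] sum_squares_bound[of "u x" "- u y"]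
        by (simp add: abs_le_iff)
      then have "Q x y * \<bar>u x * u y\<bar> \<le> Q x y * ((u x)\<^sup>2 + (u y)\<^sup>2)"
        using Q_nonneg by (intro mult_left_mono)
      then show ?thesis
        using Q_nonneg[of x y] by (simp add: riesz W_def Q_sym[of y x] abs_mult distrib_left[symmetric])
    qed
    then show "AE p in ?M \<Otimes>\<^sub>M ?M. norm (riesz_integrand \<alpha> \<phi> (fst p) (snd p))
        \<le> norm (W (fst p) (snd p) + W (snd p) (fst p))"
      by simp
  qed
  have S_eq: "remainder_integrand \<alpha> \<phi> x y = W x y + W y x - 2 * riesz_integrand \<alpha> \<phi> x y" for x y
    by (simp add: remainder riesz W_def Q_sym[of y x] power2_eq_square algebra_simps)
  have S: "integrable (?M \<Otimes>\<^sub>M ?M) (\<lambda>p. remainder_integrand \<alpha> \<phi> (fst p) (snd p))"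
    unfolding S_eq using R W W' by auto
  have "(LINT p|(?M \<Otimes>\<^sub>M ?M). remainder_integrand \<alpha> \<phi> (fst p) (snd p)) =
      2 * (C * (LINT x|?M. (\<phi> x)\<^sup>2)) - 2 * (LINT p|(?M \<Otimes>\<^sub>M ?M). riesz_integrand \<alpha> \<phi> (fst p) (snd p))"
    unfolding S_eq using R W W' W'_eq by simp
  \<comment> \<open>Fubini returns from the product integral to the iterated one, with x as the
    inner variable.\<close>
  moreover have "(LINT y|?M. LINT x|?M. remainder_integrand \<alpha> \<phi> x y)
      = (LINT p|(?M \<Otimes>\<^sub>M ?M). remainder_integrand \<alpha> \<phi> (fst p) (snd p))"
    using LP.integral_snd[of "remainder_integrand \<alpha> \<phi>"] S by (simp add: case_prod_beta')
  moreover have "(LINT y|?M. LINT x|?M. riesz_integrand \<alpha> \<phi> x y)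
      = (LINT p|(?M \<Otimes>\<^sub>M ?M). riesz_integrand \<alpha> \<phi> (fst p) (snd p))"
    using LP.integral_snd[of "riesz_integrand \<alpha> \<phi>"] R by (simp add: case_prod_beta')
  ultimately have "C * (LINT x|?M. (\<phi> x)\<^sup>2) = (LINT y|?M. LINT x|?M. riesz_integrand \<alpha> \<phi> x y)
      + 1 / 2 * (LINT y|?M. LINT x|?M. remainder_integrand \<alpha> \<phi> x y)"
    by linarith
  then show ?thesis
    using R S by (simp add: case_prod_beta' C_def)
qed

end
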